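(* Let $n=n_1+n_2+n_3=p+q$ with $\min(n_1,n_2,n_3)\ge 2$, $p=2$ and $q=n-2$. Let $G=U(n)$, and let $L=U(n_1)\times U(n_2)\times U(n_3)$ and $H=U(p)\times U(q)$ be the natural block-diagonal subgroups of $G$. Define the abelian subspaces of $\mathfrak{u}(n)$ $$\mathfrak a_1:=\mathbb{R}(E_{1,n}-E_{n,1})+\mathbb{R}(E_{2,n-1}-E_{n-1,2}),\quad \mathfrak a':=\mathbb{R}(E_{n_1+1,n-1}-E_{n-1,n_1+1}),$$ $$\mathfrak a_2:=\mathbb{R}(E_{n_1+1,n}-E_{n,n_1+1})+\mathbb{R}(E_{n_1+2,n-1}-E_{n-1,n_1+2}),$$ the toral subgroups $A_1:=\exp\mathfrak a_1$, $A':=\exp\mathfrak a'$, $A_2:=\exp\mathfrak a_2$ of $O(n)$, and the subset $B:=A_2A'A_1=\{xyz:x\in A_2,y\in A',z\in A_1\}\subset O(n)$. Then $G=LBH$.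
   Context: $E_{ij}$ denotes the $n\times n$ matrix unit with $1$ in position $(i,j)$ and $0$ elsewhere. $LBH=\{xbh:x\in L,b\in B,h\in H\}$. *)

theory Defs
  imports "Jordan_Normal_Form.Schur_Decomposition" Complex_Main
begin

definition unitary_group :: "nat \<Rightarrow> complex mat set" where
  "unitary_group n = {A \<in> carrier_mat n n. mat_adjoint A * A = 1\<^sub>m n}"

text \<open>Matrix unit E_{ij} of size n, with the paper's 1-based indices i j.\<close>
definition matunit :: "nat \<Rightarrow> nat \<Rightarrow> nat \<Rightarrow> complex mat" where
  "matunit n i j = mat n n (\<lambda>(a, b). if a = i - 1 \<and> b = j - 1 then 1 else 0)"

definition mat_exp :: "complex mat \<Rightarrow> complex mat" where
  "mat_exp X = mat (dim_row X) (dim_col X)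
     (\<lambda>(i, j). \<Sum>k. (X ^\<^sub>m k) $$ (i, j) / of_nat (fact k))"

text \<open>Block-diagonal subgroup of U(n) with respect to a partition of the index
  set {0..<n} given by a block-labelling function blk.\<close>
definition block_subgroup :: "nat \<Rightarrow> (nat \<Rightarrow> nat) \<Rightarrow> complex mat set" where
  "block_subgroup n blk = {A \<in> unitary_group n.
      \<forall>i<n. \<forall>j<n. blk i \<noteq> blk j \<longrightarrow> A $$ (i, j) = 0}"

definition blk3 :: "nat \<Rightarrow> nat \<Rightarrow> nat \<Rightarrow> nat" where
  "blk3 n1 n2 i = (if i < n1 then 0 else if i < n1 + n2 then 1 else 2)"

definition blk2 :: "nat \<Rightarrow> nat \<Rightarrow> nat" where
  "blk2 p i = (if i < p then 0 else 1)"

definition skew :: "nat \<Rightarrow> nat \<Rightarrow> nat \<Rightarrow> complex mat" where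
  "skew n i j = matunit n i j - matunit n j i"

definition rspan2 :: "complex mat \<Rightarrow> complex mat \<Rightarrow> complex mat set" where
  "rspan2 X Y = {complex_of_real s \<cdot>\<^sub>m X + complex_of_real t \<cdot>\<^sub>m Y | s t. True}"

definition rspan1 :: "complex mat \<Rightarrow> complex mat set" where
  "rspan1 X = {complex_of_real s \<cdot>\<^sub>m X | s. True}"

end

theory Submission
  imports Defs "HOL-Analysis.L2_Norm" "HOL-Combinatorics.Transposition"
    "Jordan_Normal_Form.Spectral_Radius"
begin

text \<open>Modulo \<open>H\<close>, an element of \<open>U(n)\<close> is the plane spanned by its first two columns. Modulo \<open>L\<close>,
  a basis of this plane is determined by its three \<open>2 \<times> 2\<close> Gram matrices, one for each block,
  which sum to the identity. A unitary change of basis of the plane makes the first Gram matrix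
  diagonal and the second one real; the third is then real as well. Such triples depend on five
  real parameters, and the five angles of \<open>B = A\<^sub>2 A' A\<^sub>1\<close> can be solved for explicitly.\<close>

section \<open>Unitary matrices\<close>

lemma assoc_mult_mat_dim:
  fixes A B C :: "'a :: semiring_0 mat"
  assumes "dim_col A = dim_row B" "dim_col B = dim_row C"
  shows "A * B * C = A * (B * C)"
  using assms
  by (intro assoc_mult_mat[of _ "dim_row A" "dim_col A" _ "dim_col B" _ "dim_col C"]) auto

lemma index_mult_mat_sum:
  fixes A B :: "'a :: semiring_0 mat"
  assumes "dim_col A = dim_row B" "i < dim_row A" "j < dim_col B"
  shows "(A * B) $$ (i, j) = (\<Sum>r<dim_row B. A $$ (i, r) * B $$ (r, j))"
  using assms by (simp add: scalar_prod_def atLeast0LessThan)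

lemma dim_mat_adjoint [simp]:
  "dim_row (mat_adjoint A) = dim_col A" "dim_col (mat_adjoint A) = dim_row A"
  unfolding mat_adjoint_def by simp_all

lemma mat_adjoint_carrier: "A \<in> carrier_mat n m \<Longrightarrow> mat_adjoint A \<in> carrier_mat m n"
  by (rule carrier_matI) auto

lemma index_mat_adjoint [simp]:
  assumes "i < dim_col A" "j < dim_row A"
  shows "mat_adjoint A $$ (i, j) = conjugate (A $$ (j, i))"
  using assms by (simp add: mat_adjoint_def mat_of_rows_index)

lemma mat_adjoint_adjoint [simp]: "mat_adjoint (mat_adjoint A) = A"
  by (rule eq_matI) simp_all

lemma mat_adjoint_mult:
  fixes A B :: "'a :: conjugatable_field mat"
  assumes "dim_col A = dim_row B"
  shows "mat_adjoint (A * B) = mat_adjoint B * mat_adjoint A"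
  by (rule eq_matI)
    (simp_all add: assms index_mult_mat_sum sum_conjugate conjugate_dist_mul mult.commute
      del: index_mult_mat(1))

lemma unitary_group_carrier: "A \<in> unitary_group n \<Longrightarrow> A \<in> carrier_mat n n"
  by (simp add: unitary_group_def)

lemma unitary_group_dim:
  assumes "A \<in> unitary_group n"
  shows "dim_row A = n" "dim_col A = n"
  using unitary_group_carrier[OF assms] by auto

lemma unitary_group_adjoint_mult: "A \<in> unitary_group n \<Longrightarrow> mat_adjoint A * A = 1\<^sub>m n"
  by (simp add: unitary_group_def)

lemma unitary_group_mult_adjoint: "A \<in> unitary_group n \<Longrightarrow> A * mat_adjoint A = 1\<^sub>m n"
  by (rule mat_mult_left_right_inverse[where n = n])
    (auto simp: unitary_group_def)

lemma unitary_group_cancel: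
  assumes "A \<in> unitary_group n" "dim_row X = n"
  shows "mat_adjoint A * (A * X) = X" "A * (mat_adjoint A * X) = X"
proof -
  have "mat_adjoint A * (A * X) = mat_adjoint A * A * X"
    "A * (mat_adjoint A * X) = A * mat_adjoint A * X"
    using assms(2) unitary_group_dim[OF assms(1)] by (simp_all add: assoc_mult_mat_dim)
  then show "mat_adjoint A * (A * X) = X" "A * (mat_adjoint A * X) = X"
    using assms by (simp_all add: unitary_group_adjoint_mult unitary_group_mult_adjoint)
qed

lemma unitary_group_adjoint: "A \<in> unitary_group n \<Longrightarrow> mat_adjoint A \<in> unitary_group n"
  using unitary_group_mult_adjoint[of A n] by (auto simp: unitary_group_def)

lemma unitary_group_mult:
  assumes "A \<in> unitary_group n" "B \<in> unitary_group n"
  shows "A * B \<in> unitary_group n"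
proof -
  have "mat_adjoint (A * B) * (A * B) = mat_adjoint B * B"
    using assms[THEN unitary_group_dim(1)] assms[THEN unitary_group_dim(2)]
      unitary_group_cancel(1)[OF assms(1)]
    by (simp add: mat_adjoint_mult assoc_mult_mat_dim)
  then show ?thesis using assms by (auto simp: unitary_group_def)
qed

lemma unitary_group_mult_combination:
  assumes "A \<in> unitary_group n" "v \<in> carrier_vec n" "w \<in> carrier_vec n"
  shows "A *\<^sub>v (c \<cdot>\<^sub>v v + d \<cdot>\<^sub>v w) = c \<cdot>\<^sub>v (A *\<^sub>v v) + d \<cdot>\<^sub>v (A *\<^sub>v w)"
  using assms
  by (simp add: unitary_group_def mult_add_distrib_mat_vec[of _ n n] mult_mat_vec[of _ n n])

section \<open>Block Gram matrices\<close>

definition block_inner :: "nat \<Rightarrow> (nat \<Rightarrow> nat) \<Rightarrow> nat \<Rightarrow> complex vec \<Rightarrow> complex vec \<Rightarrow> complex" where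
  "block_inner n blk k v w = (\<Sum>i | i < n \<and> blk i = k. cnj (v $ i) * w $ i)"

lemma block_inner_add:
  assumes "v \<in> carrier_vec n" "w \<in> carrier_vec n"
  shows "block_inner n blk k u (v + w) = block_inner n blk k u v + block_inner n blk k u w"
    "block_inner n blk k (v + w) u = block_inner n blk k v u + block_inner n blk k w u"
  using assms by (simp_all add: block_inner_def sum.distrib ring_distribs)

lemma block_inner_minus:
  assumes "v \<in> carrier_vec n" "w \<in> carrier_vec n"
  shows "block_inner n blk k u (v - w) = block_inner n blk k u v - block_inner n blk k u w"
    "block_inner n blk k (v - w) u = block_inner n blk k v u - block_inner n blk k w u"
  using assms by (simp_all add: block_inner_def sum_subtractf ring_distribs)

lemma block_inner_smult:
  assumes "v \<in> carrier_vec n"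
  shows "block_inner n blk k u (c \<cdot>\<^sub>v v) = c * block_inner n blk k u v"
    "block_inner n blk k (c \<cdot>\<^sub>v v) u = cnj c * block_inner n blk k v u"
  using assms by (simp_all add: block_inner_def sum_distrib_left mult_ac)

lemma cnj_block_inner: "cnj (block_inner n blk k v w) = block_inner n blk k w v"
  by (simp add: block_inner_def mult.commute)

lemma block_inner_self:
  "block_inner n blk k v v = of_real (\<Sum>i | i < n \<and> blk i = k. (cmod (v $ i))\<^sup>2)"
  unfolding block_inner_def of_real_sum
  by (rule sum.cong) (simp_all add: complex_norm_square mult.commute del: of_real_power)

lemma block_inner_self_eq_0:
  assumes "block_inner n blk k v v = 0" "i < n" "blk i = k"
  shows "v $ i = 0"
proof -
  have "(\<Sum>i | i < n \<and> blk i = k. (cmod (v $ i))\<^sup>2) = 0"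
    using assms(1) unfolding block_inner_self of_real_eq_0_iff .
  then show ?thesis
    using assms(2,3) by (subst (asm) sum_nonneg_eq_0_iff) auto
qed

lemma block_inner_Cauchy_Schwarz:
  "(cmod (block_inner n blk k v w))\<^sup>2 \<le> Re (block_inner n blk k v v) * Re (block_inner n blk k w w)"
proof -
  let ?K = "{i. i < n \<and> blk i = k}"
  have "cmod (block_inner n blk k v w) \<le> (\<Sum>i\<in>?K. \<bar>cmod (v $ i)\<bar> * \<bar>cmod (w $ i)\<bar>)"
    unfolding block_inner_def by (rule order_trans[OF norm_sum]) (simp add: norm_mult)
  also have "\<dots> \<le> L2_set (\<lambda>i. cmod (v $ i)) ?K * L2_set (\<lambda>i. cmod (w $ i)) ?K"
    by (rule L2_set_mult_ineq)
  finally have "(cmod (block_inner n blk k v w))\<^sup>2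
      \<le> (L2_set (\<lambda>i. cmod (v $ i)) ?K * L2_set (\<lambda>i. cmod (w $ i)) ?K)\<^sup>2"
    by (intro power_mono) auto
  also have "\<dots> = Re (block_inner n blk k v v) * Re (block_inner n blk k w w)"
    unfolding block_inner_self by (simp add: power_mult_distrib L2_set_def sum_nonneg)
  finally show ?thesis .
qed

lemma block_inner_unit_vec:
  assumes "i < n" "j < n"
  shows "block_inner n blk k (unit_vec n i) (unit_vec n j) = of_bool (i = j \<and> blk i = k)"
proof -
  have "block_inner n blk k (unit_vec n i) (unit_vec n j)
      = (\<Sum>r | r < n \<and> blk r = k. if r = i then of_bool (i = j) else 0)"
    unfolding block_inner_def by (rule sum.cong) (auto simp: unit_vec_def assms)
  then show ?thesis using assms by auto
qed

lemma sum_block_inner: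
  assumes "finite K" "blk ` {..<n} \<subseteq> K"
  shows "(\<Sum>k\<in>K. block_inner n blk k v w) = (\<Sum>i<n. cnj (v $ i) * w $ i)"
proof -
  have "(\<Sum>k\<in>K. block_inner n blk k v w) = (\<Sum>k\<in>K. \<Sum>i\<in>{i\<in>{..<n}. blk i = k}. cnj (v $ i) * w $ i)"
    by (simp add: block_inner_def)
  also have "\<dots> = (\<Sum>i<n. cnj (v $ i) * w $ i)"
    using assms by (intro sum.group) auto
  finally show ?thesis .
qed

definition block_proj :: "nat \<Rightarrow> (nat \<Rightarrow> nat) \<Rightarrow> nat \<Rightarrow> complex mat" where
  "block_proj n blk k = mat n n (\<lambda>(i, j). of_bool (i = j \<and> blk i = k))"

definition block_gram :: "nat \<Rightarrow> (nat \<Rightarrow> nat) \<Rightarrow> nat \<Rightarrow> complex mat \<Rightarrow> complex mat" where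
  "block_gram n blk k A = mat_adjoint A * (block_proj n blk k * A)"

lemma dim_block_proj [simp]:
  "dim_row (block_proj n blk k) = n" "dim_col (block_proj n blk k) = n"
  by (simp_all add: block_proj_def)

lemma dim_block_gram [simp]:
  "dim_row (block_gram n blk k A) = dim_col A" "dim_col (block_gram n blk k A) = dim_col A"
  by (simp_all add: block_gram_def)

lemma row_block_proj: "i < n \<Longrightarrow> row (block_proj n blk k) i = of_bool (blk i = k) \<cdot>\<^sub>v unit_vec n i"
  by (rule eq_vecI) (auto simp: block_proj_def)

lemma col_block_proj: "i < n \<Longrightarrow> col (block_proj n blk k) i = of_bool (blk i = k) \<cdot>\<^sub>v unit_vec n i"
  by (rule eq_vecI) (auto simp: block_proj_def)

lemma index_block_proj_mult:
  assumes "dim_row A = n" "i < n" "j < dim_col A"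
  shows "(block_proj n blk k * A) $$ (i, j) = of_bool (blk i = k) * A $$ (i, j)"
  using assms carrier_vecI[of "col A j" n] by (simp add: row_block_proj)

lemma index_mult_block_proj:
  assumes "dim_col A = n" "i < dim_row A" "j < n"
  shows "(A * block_proj n blk k) $$ (i, j) = of_bool (blk j = k) * A $$ (i, j)"
  using assms carrier_vecI[of "row A i" n] by (simp add: col_block_proj)

lemma index_block_gram:
  assumes "dim_row A = n" "i < dim_col A" "j < dim_col A"
  shows "block_gram n blk k A $$ (i, j) = block_inner n blk k (col A i) (col A j)"
proof -
  have "block_gram n blk k A $$ (i, j)
      = (\<Sum>r<n. if blk r = k then cnj (A $$ (r, i)) * A $$ (r, j) else 0)"
    unfolding block_gram_def using assms
    by (subst index_mult_mat_sum)
      (auto simp: index_block_proj_mult simp del: index_mult_mat(1) intro!: sum.cong)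
  also have "\<dots> = (\<Sum>r | r < n \<and> blk r = k. cnj (A $$ (r, i)) * A $$ (r, j))"
    by (subst sum.inter_filter[symmetric]) simp_all
  finally show ?thesis using assms by (simp add: block_inner_def)
qed

lemma sum_block_gram:
  assumes "finite K" "blk ` {..<n} \<subseteq> K" "dim_row A = n" "i < dim_col A" "j < dim_col A"
  shows "(\<Sum>k\<in>K. block_gram n blk k A $$ (i, j)) = (mat_adjoint A * A) $$ (i, j)"
proof -
  have "(mat_adjoint A * A) $$ (i, j) = (\<Sum>r<n. cnj (col A i $ r) * col A j $ r)"
    using assms by (subst index_mult_mat_sum) (auto intro!: sum.cong)
  then show ?thesis using assms by (simp add: index_block_gram sum_block_inner)
qed

lemma block_gram_one [simp]: "block_gram n blk k (1\<^sub>m n) = block_proj n blk k"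
proof -
  have "mat_adjoint (1\<^sub>m n) = (1\<^sub>m n :: complex mat)" by (rule eq_matI) auto
  then show ?thesis by (simp add: block_gram_def)
qed

lemma block_gram_mult_right:
  assumes "dim_row A = n" "dim_col A = dim_row V"
  shows "block_gram n blk k (A * V) = mat_adjoint V * (block_gram n blk k A * V)"
  using assms by (simp add: block_gram_def mat_adjoint_mult assoc_mult_mat_dim)

lemma block_gram_diag:
  assumes "dim_row A = n" "i < dim_col A"
  shows "block_gram n blk k A $$ (i, i) = of_real (Re (block_gram n blk k A $$ (i, i)))"
    and "Re (block_gram n blk k A $$ (i, i)) \<ge> 0"
  using assms by (simp_all add: index_block_gram block_inner_self sum_nonneg)

lemma block_gram_Cauchy_Schwarz:
  assumes "dim_row A = n" "i < dim_col A" "j < dim_col A"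
  shows "(cmod (block_gram n blk k A $$ (i, j)))\<^sup>2
    \<le> Re (block_gram n blk k A $$ (i, i)) * Re (block_gram n blk k A $$ (j, j))"
  using assms block_inner_Cauchy_Schwarz by (simp add: index_block_gram)

lemma block_gram_empty_block:
  assumes "dim_row A = n" "k \<notin> blk ` {..<n}"
  shows "block_gram n blk k A = 0\<^sub>m (dim_col A) (dim_col A)"
proof -
  have "block_inner n blk k v w = 0" for v w
    unfolding block_inner_def using assms(2) by (intro sum.neutral) auto
  then show ?thesis
    using assms(1) by (intro eq_matI) (simp_all add: index_block_gram)
qed

lemma block_gram_two_columns_eqI:
  assumes A: "A \<in> carrier_mat n 2" and C: "C \<in> carrier_mat n 2"
    and "block_gram n blk k A $$ (0, 0) = block_gram n blk k C $$ (0, 0)"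
    and "block_gram n blk k A $$ (0, 1) = block_gram n blk k C $$ (0, 1)"
    and "block_gram n blk k A $$ (1, 1) = block_gram n blk k C $$ (1, 1)"
  shows "block_gram n blk k A = block_gram n blk k C"
proof -
  have adjoint_entry: "block_gram n blk k X $$ (1, 0) = cnj (block_gram n blk k X $$ (0, 1))"
    if "X \<in> carrier_mat n 2" for X
    using that by (simp add: index_block_gram cnj_block_inner)
  show ?thesis
    using assms adjoint_entry[OF A] adjoint_entry[OF C]
    by (intro eq_matI) (auto simp: less_2_cases_iff)
qed

section \<open>Block-diagonal unitary matrices\<close>

lemma block_subgroup_iff_commute:
  "A \<in> block_subgroup n blk \<longleftrightarrow>
     A \<in> unitary_group n \<and> (\<forall>k. block_proj n blk k * A = A * block_proj n blk k)"
proof -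
  have "(\<forall>k. block_proj n blk k * A = A * block_proj n blk k) \<longleftrightarrow>
      (\<forall>i<n. \<forall>j<n. \<forall>k. of_bool (blk i = k) * A $$ (i, j) = of_bool (blk j = k) * A $$ (i, j))"
    if "A \<in> unitary_group n"
    using unitary_group_dim[OF that]
    by (auto simp: mat_eq_iff index_block_proj_mult index_mult_block_proj
        simp del: index_mult_mat(1))
  moreover have "(\<forall>k. of_bool (r = k) * x = of_bool (s = k) * x) \<longleftrightarrow> (r \<noteq> s \<longrightarrow> x = 0)"
    for r s :: nat and x :: complex
    by auto
  ultimately show ?thesis by (auto simp: block_subgroup_def)
qed

lemma block_gram_block_subgroup_mult:
  assumes "l \<in> block_subgroup n blk" "dim_row A = n"
  shows "block_gram n blk k (l * A) = block_gram n blk k A"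
proof -
  have l: "l \<in> unitary_group n" "block_proj n blk k * l = l * block_proj n blk k"
    using assms by (auto simp: block_subgroup_iff_commute)
  have "block_gram n blk k (l * A)
      = mat_adjoint A * (mat_adjoint l * ((block_proj n blk k * l) * A))"
    using assms(2) unitary_group_dim[OF l(1)]
    by (simp add: block_gram_def mat_adjoint_mult assoc_mult_mat_dim)
  also have "\<dots> = block_gram n blk k A"
    using assms(2) unitary_group_dim[OF l(1)] unitary_group_cancel(1)[OF l(1)] unfolding l(2)
    by (simp add: block_gram_def assoc_mult_mat_dim)
  finally show ?thesis .
qed

lemma block_subgroupI_block_gram:
  assumes A: "A \<in> carrier_mat n n" and gram: "\<And>k. block_gram n blk k A = block_proj n blk k"
  shows "A \<in> block_subgroup n blk"
proof -
  have "mat_adjoint A * A = 1\<^sub>m n"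
  proof (rule eq_matI)
    fix i j assume "i < dim_row (1\<^sub>m n :: complex mat)" "j < dim_col (1\<^sub>m n :: complex mat)"
    then have ij: "i < n" "j < n" by auto
    have "(mat_adjoint A * A) $$ (i, j) = (\<Sum>k\<in>blk ` {..<n}. block_proj n blk k $$ (i, j))"
      using A ij sum_block_gram[of "blk ` {..<n}" blk n A i j] by (simp add: gram)
    also have "\<dots> = 1\<^sub>m n $$ (i, j)"
      using ij by (simp add: block_proj_def of_bool_def)
    finally show "(mat_adjoint A * A) $$ (i, j) = 1\<^sub>m n $$ (i, j)" .
  qed (use A in auto)
  then have U: "A \<in> unitary_group n" using A by (simp add: unitary_group_def)
  have "block_proj n blk k * A = A * block_gram n blk k A" for k
    using A unitary_group_cancel(2)[OF U] by (simp add: block_gram_def)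
  then show ?thesis using U by (simp add: block_subgroup_iff_commute gram)
qed

lemma block_subgroup_unitary: "A \<in> block_subgroup n blk \<Longrightarrow> A \<in> unitary_group n"
  by (simp add: block_subgroup_def)

lemma block_subgroup_one: "1\<^sub>m n \<in> block_subgroup n blk"
  by (rule block_subgroupI_block_gram) simp_all

lemma block_subgroup_mult:
  assumes "A \<in> block_subgroup n blk" "B \<in> block_subgroup n blk"
  shows "A * B \<in> block_subgroup n blk"
proof (rule block_subgroupI_block_gram)
  have dim: "A \<in> carrier_mat n n" "B \<in> carrier_mat n n"
    using assms by (auto intro: unitary_group_carrier block_subgroup_unitary)
  then show "A * B \<in> carrier_mat n n" by simp
  show "block_gram n blk k (A * B) = block_proj n blk k" for k
    using block_gram_block_subgroup_mult[OF assms(1), of B]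
      block_gram_block_subgroup_mult[OF assms(2), of "1\<^sub>m n"] dim by simp
qed

lemma block_subgroup_adjoint:
  assumes "A \<in> block_subgroup n blk"
  shows "mat_adjoint A \<in> block_subgroup n blk"
  using assms unitary_group_adjoint[of A n]
  by (auto simp: block_subgroup_def unitary_group_def)

definition block_reflection ::
    "nat \<Rightarrow> (nat \<Rightarrow> nat) \<Rightarrow> (nat \<Rightarrow> complex) \<Rightarrow> complex vec \<Rightarrow> complex mat" where
  "block_reflection n blk \<tau> w = mat n n (\<lambda>(i, j). of_bool (i = j) -
     (if blk j = blk i then \<tau> (blk i) * w $ i * cnj (w $ j) else 0))"

lemma block_reflection_carrier: "block_reflection n blk \<tau> w \<in> carrier_mat n n"
  by (simp add: block_reflection_def)

lemma block_reflection_mult_vec: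
  assumes "i < n" "x \<in> carrier_vec n"
  shows "(block_reflection n blk \<tau> w *\<^sub>v x) $ i
    = x $ i - \<tau> (blk i) * w $ i * block_inner n blk (blk i) w x"
proof -
  have "(block_reflection n blk \<tau> w *\<^sub>v x) $ i = (\<Sum>r<n. (if r = i then x $ r else 0) -
      (if blk r = blk i then \<tau> (blk i) * w $ i * (cnj (w $ r) * x $ r) else 0))"
    using assms by (auto simp: block_reflection_def scalar_prod_def atLeast0LessThan algebra_simps
        intro!: sum.cong)
  also have "\<dots>
      = x $ i - (\<Sum>r | r \<in> {..<n} \<and> blk r = blk i. \<tau> (blk i) * w $ i * (cnj (w $ r) * x $ r))"
    using assms by (subst sum.inter_filter) (simp_all add: sum_subtractf)
  finally show ?thesis by (simp add: block_inner_def sum_distrib_left)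
qed

lemma block_inner_block_reflection:
  assumes "x \<in> carrier_vec n"
  shows "block_inner n blk k u (block_reflection n blk \<tau> w *\<^sub>v x)
      = block_inner n blk k u x - \<tau> k * block_inner n blk k w x * block_inner n blk k u w"
proof -
  have "block_inner n blk k u (block_reflection n blk \<tau> w *\<^sub>v x)
      = (\<Sum>i | i < n \<and> blk i = k.
          cnj (u $ i) * x $ i - \<tau> k * block_inner n blk k w x * (cnj (u $ i) * w $ i))"
    unfolding block_inner_def[of n blk k u]
    by (intro sum.cong refl)
      (use assms in \<open>simp add: block_reflection_mult_vec algebra_simps del: index_mult_mat_vec\<close>)
  then show ?thesis by (simp add: block_inner_def sum_subtractf sum_distrib_left)
qed

lemma block_reflection_in_block_subgroup:
  assumes \<tau>: "\<And>k. \<tau> k + cnj (\<tau> k) = \<tau> k * cnj (\<tau> k) * block_inner n blk k w w"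
  shows "block_reflection n blk \<tau> w \<in> block_subgroup n blk"
proof (rule block_subgroupI_block_gram[OF block_reflection_carrier])
  fix k
  let ?R = "block_reflection n blk \<tau> w"
  note R = block_reflection_carrier[of n blk \<tau> w]
  have preserve: "block_inner n blk k (?R *\<^sub>v x) (?R *\<^sub>v y) = block_inner n blk k x y"
    if x: "x \<in> carrier_vec n" and y: "y \<in> carrier_vec n" for x y
  proof -
    have left: "block_inner n blk k (?R *\<^sub>v x) v
        = block_inner n blk k x v
          - cnj (\<tau> k) * block_inner n blk k x w * block_inner n blk k w v" for v
      using arg_cong[OF block_inner_block_reflection[OF x, of blk k v \<tau> w], of cnj]
      by (simp add: cnj_block_inner)
    have "block_inner n blk k (?R *\<^sub>v x) (?R *\<^sub>v y) = block_inner n blk k x y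
        - block_inner n blk k x w * block_inner n blk k w y
          * (\<tau> k + cnj (\<tau> k) - \<tau> k * cnj (\<tau> k) * block_inner n blk k w w)"
      by (simp add: block_inner_block_reflection[OF y] left algebra_simps)
    then show ?thesis by (simp add: \<tau>)
  qed
  have "col ?R i = ?R *\<^sub>v unit_vec n i" if "i < n" for i
    using col_mult2[OF R one_carrier_mat that] R that by simp
  then have "block_gram n blk k ?R = block_gram n blk k (1\<^sub>m n)"
    using R by (intro eq_matI) (simp_all add: index_block_gram preserve del: block_gram_one)
  then show "block_gram n blk k ?R = block_proj n blk k" by simp
qed

text \<open>The reflection at \<open>w = a - c\<close> with \<open>\<tau> = 1 / \<langle>w, a\<rangle>\<close> in every block; \<open>2 Re \<langle>w, a\<rangle> = \<langle>w, w\<rangle>\<close>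
  makes it unitary. If \<open>w\<close> vanishes on a block, then \<open>1 / 0 = 0\<close> makes it the identity there.\<close>
lemma block_reflection_exchange:
  assumes a: "a \<in> carrier_vec n" and c: "c \<in> carrier_vec n"
    and norm_eq: "\<And>k. block_inner n blk k a a = block_inner n blk k c c"
  obtains R where "R \<in> block_subgroup n blk" "R *\<^sub>v a = c"
    "\<And>x. x \<in> carrier_vec n \<Longrightarrow> (\<And>k. block_inner n blk k (a - c) x = 0) \<Longrightarrow> R *\<^sub>v x = x"
proof -
  define w where "w = a - c"
  define D where "D k = block_inner n blk k w a" for k
  define R where "R = block_reflection n blk (\<lambda>k. 1 / D k) w"
  note R_carrier = block_reflection_carrier[of n blk "\<lambda>k. 1 / D k" w, folded R_def]
  note R_mult = block_reflection_mult_vec[of _ n _ blk "\<lambda>k. 1 / D k" w, folded R_def]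
  have norm_w: "block_inner n blk k w w = D k + cnj (D k)" for k
    unfolding D_def w_def cnj_block_inner using a c by (simp add: block_inner_minus norm_eq)
  have "R \<in> block_subgroup n blk"
    unfolding R_def
  proof (rule block_reflection_in_block_subgroup)
    show "1 / D k + cnj (1 / D k) = 1 / D k * cnj (1 / D k) * block_inner n blk k w w" for k
      unfolding norm_w by (cases "D k = 0") (simp_all add: field_simps)
  qed
  moreover have "R *\<^sub>v a = c"
  proof (rule eq_vecI)
    fix i assume "i < dim_vec c"
    then have i: "i < n" using c by simp
    have "w $ i = 0" if "D (blk i) = 0"
      using block_inner_self_eq_0[of n blk "blk i" w i] norm_w[of "blk i"] that i by simp
    then have "(R *\<^sub>v a) $ i = a $ i - w $ i"
      unfolding R_mult[OF i a] D_def[symmetric] by (cases "D (blk i) = 0") simp_all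
    then show "(R *\<^sub>v a) $ i = c $ i" using i a c by (simp add: w_def)
  qed (use R_carrier c in auto)
  moreover have "R *\<^sub>v x = x"
    if "x \<in> carrier_vec n" "\<And>k. block_inner n blk k (a - c) x = 0" for x
    by (rule eq_vecI) (use R_carrier that in \<open>auto simp: R_mult w_def simp del: index_mult_mat_vec\<close>)
  ultimately show ?thesis by (rule that)
qed

text \<open>Equality of the Gram matrices makes the vector of the reflection blockwise orthogonal to the
  columns that already agree.\<close>
lemma block_subgroup_match_column:
  assumes B: "B \<in> carrier_mat n m" and C: "C \<in> carrier_mat n m" and j: "j < m"
    and gram: "\<And>k. block_gram n blk k B = block_gram n blk k C"
    and agree: "\<And>i. i < j \<Longrightarrow> col B i = col C i"
  obtains R where "R \<in> block_subgroup n blk" "\<And>i. i \<le> j \<Longrightarrow> col (R * B) i = col C i"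
proof -
  let ?b = "col B j" and ?c = "col C j"
  have carrier: "?b \<in> carrier_vec n" "?c \<in> carrier_vec n" using B C by auto
  have inner_eq: "block_inner n blk k (col B r) (col B s) = block_inner n blk k (col C r) (col C s)"
    if "r < m" "s < m" for k r s
    using that B C gram[of k] by (simp flip: index_block_gram)
  obtain R where R: "R \<in> block_subgroup n blk" "R *\<^sub>v ?b = ?c"
    and fix_orthogonal:
      "\<And>x. x \<in> carrier_vec n \<Longrightarrow> (\<And>k. block_inner n blk k (?b - ?c) x = 0) \<Longrightarrow> R *\<^sub>v x = x"
    using block_reflection_exchange[OF carrier] inner_eq[OF j j] by metis
  have fixed: "R *\<^sub>v col C i = col C i" if "i < j" for i
  proof (rule fix_orthogonal)
    show "block_inner n blk k (?b - ?c) (col C i) = 0" for k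
      using inner_eq[of j i k] agree[OF that] that j by (simp add: block_inner_minus[OF carrier])
  qed (use C in auto)
  have "col (R * B) i = col C i" if "i \<le> j" for i
  proof -
    have "R \<in> carrier_mat n n" using R(1) by (intro unitary_group_carrier block_subgroup_unitary)
    then have "col (R * B) i = R *\<^sub>v col B i" using col_mult2 B that j by (metis le_less_trans)
    then show ?thesis using that R(2) agree fixed by (cases "i = j") auto
  qed
  with R(1) show ?thesis by (rule that)
qed

lemma block_subgroup_transitive:
  assumes A: "A \<in> carrier_mat n m" and C: "C \<in> carrier_mat n m"
    and gram: "\<And>k. block_gram n blk k A = block_gram n blk k C"
  obtains l where "l \<in> block_subgroup n blk" "l * A = C"
proof -
  have "\<exists>l\<in>block_subgroup n blk. \<forall>i<j. col (l * A) i = col C i" if "j \<le> m" for j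
    using that
  proof (induction j)
    case 0
    then show ?case using block_subgroup_one by blast
  next
    case (Suc j)
    then obtain l where l: "l \<in> block_subgroup n blk" "\<And>i. i < j \<Longrightarrow> col (l * A) i = col C i"
      by auto
    note l_dim = unitary_group_dim[OF block_subgroup_unitary[OF l(1)]]
    have "block_gram n blk k (l * A) = block_gram n blk k C" for k
      using block_gram_block_subgroup_mult[OF l(1)] A gram by simp
    then obtain R where R: "R \<in> block_subgroup n blk" "\<And>i. i \<le> j \<Longrightarrow> col (R * (l * A)) i = col C i"
      using block_subgroup_match_column[of "l * A" n m C j blk] A C l l_dim Suc.prems
      by (metis Suc_le_lessD carrier_matD carrier_matI index_mult_mat(2,3))
    have "R * l * A = R * (l * A)"
      using A l_dim unitary_group_dim[OF block_subgroup_unitary[OF R(1)]]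
      by (simp add: assoc_mult_mat_dim)
    then show ?case using R block_subgroup_mult[OF R(1) l(1)] by (metis less_Suc_eq_le)
  qed
  then obtain l where l: "l \<in> block_subgroup n blk" "\<forall>i<m. col (l * A) i = col C i" by blast
  have "l * A = C"
    using l(2) A C unitary_group_dim[OF block_subgroup_unitary[OF l(1)]]
    by (intro mat_col_eqI) auto
  with l(1) show ?thesis by (rule that)
qed

section \<open>Double cosets\<close>

definition coordinate_frame :: "nat \<Rightarrow> nat \<Rightarrow> complex mat" where
  "coordinate_frame n p = mat n p (\<lambda>(i, j). of_bool (i = j))"

lemma dim_coordinate_frame [simp]:
  "dim_row (coordinate_frame n p) = n" "dim_col (coordinate_frame n p) = p"
  by (simp_all add: coordinate_frame_def)

lemma col_coordinate_frame: "j < p \<Longrightarrow> col (coordinate_frame n p) j = unit_vec n j"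
  by (rule eq_vecI) (auto simp: coordinate_frame_def unit_vec_def)

lemma col_mult_coordinate_frame:
  assumes "A \<in> carrier_mat n n" "j < p"
  shows "col (A * coordinate_frame n p) j = A *\<^sub>v unit_vec n j"
  using col_mult2[OF assms(1) carrier_matI[OF dim_coordinate_frame] assms(2)]
    col_coordinate_frame[OF assms(2)]
  by simp

lemma coordinate_frame_orthonormal:
  assumes "p \<le> n"
  shows "mat_adjoint (coordinate_frame n p) * coordinate_frame n p = 1\<^sub>m p"
  using assms
  by (intro eq_matI)
    (auto simp: index_mult_mat_sum coordinate_frame_def simp del: index_mult_mat(1))

lemma index_coordinate_frame_mult:
  assumes "dim_row W = p" "i < n" "j < dim_col W"
  shows "(coordinate_frame n p * W) $$ (i, j) = (if i < p then W $$ (i, j) else 0)"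
proof -
  have "row (coordinate_frame n p) i = (if i < p then unit_vec p i else 0\<^sub>v p)"
    by (rule eq_vecI) (use assms in \<open>auto simp: coordinate_frame_def\<close>)
  then show ?thesis using assms carrier_vecI[of "col W j" p] by simp
qed

lemma frame_stable_imp_lower_left_0:
  assumes X: "X \<in> carrier_mat n n" and Y: "Y \<in> carrier_mat p p"
    and stable: "X * coordinate_frame n p = coordinate_frame n p * Y"
    and ij: "p \<le> i" "i < n" "j < p"
  shows "X $$ (i, j) = 0"
proof -
  have "X $$ (i, j) = (X * coordinate_frame n p) $$ (i, j)"
    using ij X carrier_vecI[of "row X i" n] by (simp add: col_coordinate_frame)
  also have "\<dots> = 0"
    using ij Y unfolding stable by (simp add: index_coordinate_frame_mult del: index_mult_mat(1))
  finally show ?thesis .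
qed

lemma unitary_frame_stable_imp_block_subgroup:
  assumes K: "K \<in> unitary_group n" and W: "W \<in> unitary_group p"
    and stable: "K * coordinate_frame n p = coordinate_frame n p * W"
  shows "K \<in> block_subgroup n (blk2 p)"
proof -
  let ?E = "coordinate_frame n p"
  note carriers = K[THEN unitary_group_carrier] W[THEN unitary_group_carrier]
  note adjoint_carriers = carriers[THEN mat_adjoint_carrier]
  have "mat_adjoint K * ?E = mat_adjoint K * (?E * W) * mat_adjoint W"
    using unitary_group_dim[OF K] unitary_group_dim[OF W] unitary_group_mult_adjoint[OF W]
    by (simp add: assoc_mult_mat_dim)
  also have "\<dots> = ?E * mat_adjoint W"
    unfolding stable[symmetric] using unitary_group_cancel(1)[OF K] by simp
  finally have stable_adjoint: "mat_adjoint K * ?E = ?E * mat_adjoint W" .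
  have "K $$ (i, j) = 0" if ij: "i < n" "j < n" "blk2 p i \<noteq> blk2 p j" for i j
  proof (cases "i < p")
    case True
    then have "p \<le> j" using ij by (simp add: blk2_def split: if_splits)
    then have "mat_adjoint K $$ (j, i) = 0"
      using frame_stable_imp_lower_left_0[OF adjoint_carriers stable_adjoint] True ij by blast
    then show ?thesis using ij unitary_group_dim[OF K] by simp
  next
    case False
    then have "j < p" using ij by (simp add: blk2_def split: if_splits)
    with False show ?thesis
      using frame_stable_imp_lower_left_0[OF carriers stable] ij by simp
  qed
  then show ?thesis using K by (simp add: block_subgroup_def)
qed

lemma double_coset_if_block_gram_eq:
  assumes g: "g \<in> unitary_group n" and M: "M \<in> unitary_group n" and V: "V \<in> unitary_group p"
    and gram: "\<And>k. block_gram n blk k (M * coordinate_frame n p)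
      = block_gram n blk k (g * coordinate_frame n p * V)"
  obtains l h where "l \<in> block_subgroup n blk" "h \<in> block_subgroup n (blk2 p)" "g = l * M * h"
proof -
  let ?E = "coordinate_frame n p"
  have "g * ?E * V \<in> carrier_mat n p" "M * ?E \<in> carrier_mat n p"
    using unitary_group_dim[OF g] unitary_group_dim[OF M] unitary_group_dim[OF V] by auto
  then obtain l where l: "l \<in> block_subgroup n blk" "l * (g * ?E * V) = M * ?E"
    using block_subgroup_transitive gram by metis
  note l_unitary = block_subgroup_unitary[OF l(1)]
  note dims = unitary_group_dim[OF g] unitary_group_dim[OF M] unitary_group_dim[OF V]
    unitary_group_dim[OF l_unitary]
  define K where "K = mat_adjoint M * (l * g)"
  have K: "K \<in> unitary_group n"
    unfolding K_def by (intro unitary_group_mult unitary_group_adjoint M l_unitary g)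
  have "K * ?E = mat_adjoint M * (l * (g * ?E * V)) * mat_adjoint V"
    using dims unitary_group_mult_adjoint[OF V] by (simp add: K_def assoc_mult_mat_dim)
  also have "\<dots> = ?E * mat_adjoint V"
    unfolding l(2) using unitary_group_cancel(1)[OF M] by simp
  finally have "K \<in> block_subgroup n (blk2 p)"
    by (rule unitary_frame_stable_imp_block_subgroup[OF K unitary_group_adjoint[OF V]])
  moreover have "g = mat_adjoint l * M * K"
    using dims unitary_group_cancel(2)[OF M] unitary_group_cancel(1)[OF l_unitary]
    by (simp add: K_def assoc_mult_mat_dim)
  ultimately show ?thesis using that block_subgroup_adjoint[OF l(1)] by blast
qed

section \<open>Exponentials of commuting plane rotations\<close>

abbreviation plane_unit_vec :: "nat \<Rightarrow> nat \<Rightarrow> nat \<Rightarrow> real \<Rightarrow> complex vec" where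
  "plane_unit_vec n i j \<phi> \<equiv>
    of_real (cos \<phi>) \<cdot>\<^sub>v unit_vec n i + of_real (sin \<phi>) \<cdot>\<^sub>v unit_vec n j"

locale plane_rotations =
  fixes n :: nat and \<sigma> :: "nat \<Rightarrow> nat" and \<theta> :: "nat \<Rightarrow> real"
  assumes involution_less: "a < n \<Longrightarrow> \<sigma> a < n"
    and involution: "a < n \<Longrightarrow> \<sigma> (\<sigma> a) = a"
    and angle_odd: "a < n \<Longrightarrow> \<theta> (\<sigma> a) = - \<theta> a"
begin

definition generator :: "complex mat" where
  "generator = mat n n (\<lambda>(a, b). if b = \<sigma> a then of_real (\<theta> a) else 0)"

definition rotation :: "complex mat" where
  "rotation = mat n n (\<lambda>(a, b). (if b = a then of_real (cos (\<theta> a)) else 0)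
     + (if b = \<sigma> a then of_real (sin (\<theta> a)) else 0))"

lemma generator_power:
  assumes "a < n" "b < n"
  shows "(generator ^\<^sub>m m) $$ (a, b) =
      (if b = a then of_real (fact m * (cos_coeff m * \<theta> a ^ m)) else 0)
      + (if b = \<sigma> a then of_real (fact m * (sin_coeff m * \<theta> a ^ m)) else 0)"
  using assms
proof (induction m arbitrary: a b)
  case 0
  then show ?case by (simp add: generator_def)
next
  case (Suc m)
  let ?c = "fact m * (cos_coeff m * \<theta> a ^ m)" and ?s = "fact m * (sin_coeff m * \<theta> a ^ m)"
  have "(generator ^\<^sub>m Suc m) $$ (a, b) = (\<Sum>r<n. (generator ^\<^sub>m m) $$ (a, r) * generator $$ (r, b))"
    using Suc.prems by (simp add: index_mult_mat_sum generator_def del: index_mult_mat(1))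
  also have "\<dots> = (\<Sum>r<n. (if r = a then of_real ?c * generator $$ (r, b) else 0)
      + (if r = \<sigma> a then of_real ?s * generator $$ (r, b) else 0))"
    by (rule sum.cong) (use Suc in \<open>simp_all add: distrib_right\<close>)
  also have "\<dots> = of_real ?c * generator $$ (a, b) + of_real ?s * generator $$ (\<sigma> a, b)"
    using Suc.prems involution_less by (simp add: sum.distrib)
  also have "\<dots> = (if b = a then of_real (- ?s * \<theta> a) else 0)
      + (if b = \<sigma> a then of_real (?c * \<theta> a) else 0)"
    using Suc.prems involution_less involution angle_odd[of a] by (auto simp: generator_def)
  also have "- ?s * \<theta> a = fact (Suc m) * (cos_coeff (Suc m) * \<theta> a ^ Suc m)"
    by (simp add: cos_coeff_Suc field_simps del: of_nat_Suc)
  also have "?c * \<theta> a = fact (Suc m) * (sin_coeff (Suc m) * \<theta> a ^ Suc m)"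
    by (simp add: sin_coeff_Suc field_simps del: of_nat_Suc)
  finally show ?case .
qed

lemma mat_exp_generator: "mat_exp generator = rotation"
proof -
  have cos: "(\<lambda>m. of_real (cos_coeff m * \<theta> a ^ m)) sums (of_real (cos (\<theta> a)) :: complex)" for a
    using cos_converges[of "\<theta> a"] by (intro sums_of_real) simp
  have sin: "(\<lambda>m. of_real (sin_coeff m * \<theta> a ^ m)) sums (of_real (sin (\<theta> a)) :: complex)" for a
    using sin_converges[of "\<theta> a"] by (intro sums_of_real) simp
  have "(\<lambda>m. (generator ^\<^sub>m m) $$ (a, b) / of_nat (fact m)) sums (rotation $$ (a, b))"
    if "a < n" "b < n" for a b
  proof -
    have "(\<lambda>m. (generator ^\<^sub>m m) $$ (a, b) / of_nat (fact m)) =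
        (\<lambda>m. (if b = a then of_real (cos_coeff m * \<theta> a ^ m) else 0)
          + (if b = \<sigma> a then of_real (sin_coeff m * \<theta> a ^ m) else 0))"
      by (simp add: fun_eq_iff generator_power[OF that] add_divide_distrib)
    moreover have "\<dots> sums ((if b = a then of_real (cos (\<theta> a)) else 0)
          + (if b = \<sigma> a then of_real (sin (\<theta> a)) else 0))"
      by (intro sums_add) (use cos sin in simp_all)
    ultimately show ?thesis using that by (simp add: rotation_def)
  qed
  then show ?thesis
    by (intro eq_matI) (simp_all add: mat_exp_def generator_def rotation_def sums_unique[symmetric])
qed

lemma rotation_carrier: "rotation \<in> carrier_mat n n"
  by (simp add: rotation_def)

lemma rotation_mult_unit_vec:
  assumes "a < n"
  shows "rotation *\<^sub>v unit_vec n a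
    = plane_unit_vec n a (\<sigma> a) (- \<theta> a)"
proof (rule eq_vecI)
  fix b assume "b < dim_vec (plane_unit_vec n a (\<sigma> a) (- \<theta> a) :: complex vec)"
  then have b: "b < n" by simp
  then have "a = \<sigma> b \<longleftrightarrow> b = \<sigma> a" using assms involution by auto
  then show "(rotation *\<^sub>v unit_vec n a) $ b
      = (plane_unit_vec n a (\<sigma> a) (- \<theta> a)) $ b"
    using assms b involution_less angle_odd[of a] by (auto simp: rotation_def)
qed (simp add: rotation_def)

lemma rotation_fixes_unit_vec:
  assumes "a < n" "\<theta> a = 0"
  shows "rotation *\<^sub>v unit_vec n a = unit_vec n a"
  unfolding rotation_mult_unit_vec[OF assms(1)]
  by (rule eq_vecI) (use assms involution_less in auto)

lemma rotation_unitary: "rotation \<in> unitary_group n"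
proof -
  have "mat_adjoint rotation * rotation = 1\<^sub>m n"
  proof (rule eq_matI)
    fix a b assume "a < dim_row (1\<^sub>m n :: complex mat)" "b < dim_col (1\<^sub>m n :: complex mat)"
    then have ab: "a < n" "b < n" by auto
    have col: "cnj (rotation $$ (r, a)) =
        (if r = a then of_real (cos (\<theta> a)) else 0) + (if r = \<sigma> a then - of_real (sin (\<theta> a)) else 0)"
      if "r < n" for r
    proof -
      have "a = \<sigma> r \<longleftrightarrow> r = \<sigma> a" using involution that ab by metis
      then show ?thesis using that ab angle_odd[of a] involution_less by (auto simp: rotation_def)
    qed
    have "(mat_adjoint rotation * rotation) $$ (a, b)
        = (\<Sum>r<n. cnj (rotation $$ (r, a)) * rotation $$ (r, b))"
      using ab rotation_carrier by (simp add: index_mult_mat_sum del: index_mult_mat(1))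
    also have "\<dots> = (\<Sum>r<n. (if r = a then of_real (cos (\<theta> a)) * rotation $$ (r, b) else 0)
          + (if r = \<sigma> a then - of_real (sin (\<theta> a)) * rotation $$ (r, b) else 0))"
      by (rule sum.cong) (simp_all add: col distrib_right)
    also have "\<dots> = of_real (cos (\<theta> a)) * rotation $$ (a, b)
        - of_real (sin (\<theta> a)) * rotation $$ (\<sigma> a, b)"
      using ab involution_less by (simp add: sum.distrib)
    also have "\<dots> = (if b = a then of_real ((cos (\<theta> a))\<^sup>2 + (sin (\<theta> a))\<^sup>2) else 0)"
      using ab involution_less involution angle_odd unfolding of_real_add
      by (simp add: rotation_def power2_eq_square algebra_simps)
    finally show "(mat_adjoint rotation * rotation) $$ (a, b) = 1\<^sub>m n $$ (a, b)"
      using ab by (auto simp del: of_real_add)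
  qed (use rotation_carrier in auto)
  then show ?thesis using rotation_carrier by (simp add: unitary_group_def)
qed

end

lemma dim_skew: "dim_row (skew n i j) = n" "dim_col (skew n i j) = n"
  by (simp_all add: skew_def matunit_def)

lemma index_skew:
  assumes "a < n" "b < n"
  shows "skew n (Suc i) (Suc j) $$ (a, b)
    = (if a = i \<and> b = j then 1 else 0) - (if a = j \<and> b = i then 1 else 0)"
  using assms by (simp add: skew_def matunit_def del: if_split)

lemma mat_exp_skew:
  fixes s :: real
  assumes ij: "i < n" "j < n" "i \<noteq> j"
  defines "X \<equiv> mat_exp (of_real s \<cdot>\<^sub>m skew n (Suc i) (Suc j))"
  shows "X \<in> unitary_group n" (is ?unitary)
    and "X *\<^sub>v unit_vec n i = plane_unit_vec n i j (- s)" (is ?first)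
    and "X *\<^sub>v unit_vec n j = plane_unit_vec n j i s" (is ?second)
    and "\<And>a. a < n \<Longrightarrow> a \<notin> {i, j} \<Longrightarrow> X *\<^sub>v unit_vec n a = unit_vec n a"
proof -
  interpret plane_rotations n "transpose i j" "(\<lambda>_. 0)(i := s, j := - s)"
    by unfold_locales (use ij in \<open>auto simp: transpose_def\<close>)
  have "of_real s \<cdot>\<^sub>m skew n (Suc i) (Suc j) = generator"
    by (rule eq_matI) (use ij in \<open>auto simp: index_skew dim_skew generator_def transpose_def\<close>)
  then have X: "X = rotation" by (simp add: X_def mat_exp_generator)
  show ?unitary unfolding X by (rule rotation_unitary)
  show ?first ?second using ij unfolding X by (simp_all add: rotation_mult_unit_vec)
  show "X *\<^sub>v unit_vec n a = unit_vec n a" if "a < n" "a \<notin> {i, j}" for a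
    unfolding X by (rule rotation_fixes_unit_vec) (use that in auto)
qed

lemma plane_rotations_skew_pair:
  fixes s t :: real
  assumes less: "i < n" "j < n" "k < n" "l < n" and distinct: "distinct [i, j, k, l]"
  obtains \<sigma> \<theta> where "plane_rotations n \<sigma> \<theta>"
    "of_real s \<cdot>\<^sub>m skew n (Suc i) (Suc j) + of_real t \<cdot>\<^sub>m skew n (Suc k) (Suc l)
      = plane_rotations.generator n \<sigma> \<theta>"
    "\<sigma> i = j" "\<sigma> j = i" "\<sigma> k = l" "\<sigma> l = k" "\<theta> i = s" "\<theta> j = - s" "\<theta> k = t" "\<theta> l = - t"
    "\<And>a. a \<notin> {i, j, k, l} \<Longrightarrow> \<theta> a = 0"
proof -
  have neq: "i \<noteq> j" "i \<noteq> k" "i \<noteq> l" "j \<noteq> k" "j \<noteq> l" "k \<noteq> l" using distinct by auto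
  define \<sigma> where "\<sigma> = transpose i j \<circ> transpose k l"
  define \<theta> where "\<theta> = (\<lambda>_. 0)(i := s, j := - s, k := t, l := - t)"
  have \<sigma>: "\<sigma> i = j" "\<sigma> j = i" "\<sigma> k = l" "\<sigma> l = k" "\<And>a. a \<notin> {i, j, k, l} \<Longrightarrow> \<sigma> a = a"
    by (simp_all add: \<sigma>_def neq neq[symmetric])
  have \<theta>: "\<theta> i = s" "\<theta> j = - s" "\<theta> k = t" "\<theta> l = - t" "\<And>a. a \<notin> {i, j, k, l} \<Longrightarrow> \<theta> a = 0"
    by (simp_all add: \<theta>_def neq neq[symmetric])
  have index_cases: "P a" if "P i" "P j" "P k" "P l" "a \<notin> {i, j, k, l} \<Longrightarrow> P a" for P a
    using that by blast
  have "\<sigma> a < n \<and> \<sigma> (\<sigma> a) = a \<and> \<theta> (\<sigma> a) = - \<theta> a" if "a < n" for a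
    by (rule index_cases[of _ a]) (use that in \<open>simp_all add: \<sigma> \<theta> less\<close>)
  then interpret plane_rotations n \<sigma> \<theta>
    by unfold_locales auto
  have "of_real s \<cdot>\<^sub>m skew n (Suc i) (Suc j) + of_real t \<cdot>\<^sub>m skew n (Suc k) (Suc l) = generator"
  proof (rule eq_matI)
    fix a b assume "a < dim_row generator" "b < dim_col generator"
    then have ab: "a < n" "b < n" by (auto simp: generator_def)
    show "(of_real s \<cdot>\<^sub>m skew n (Suc i) (Suc j) + of_real t \<cdot>\<^sub>m skew n (Suc k) (Suc l)) $$ (a, b)
        = generator $$ (a, b)"
      by (rule index_cases[of _ a])
        (simp_all add: ab neq neq[symmetric] less index_skew dim_skew generator_def \<sigma> \<theta>)
  qed (simp_all add: dim_skew generator_def)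
  with plane_rotations_axioms \<sigma>(1-4) \<theta> show ?thesis by (intro that)
qed

lemma mat_exp_skew_pair:
  fixes s t :: real
  assumes less: "i < n" "j < n" "k < n" "l < n" and distinct: "distinct [i, j, k, l]"
  defines "X \<equiv> mat_exp (of_real s \<cdot>\<^sub>m skew n (Suc i) (Suc j) + of_real t \<cdot>\<^sub>m skew n (Suc k) (Suc l))"
  shows "X \<in> unitary_group n" (is ?unitary)
    and "X *\<^sub>v unit_vec n i = plane_unit_vec n i j (- s)" (is ?first)
    and "X *\<^sub>v unit_vec n j = plane_unit_vec n j i s" (is ?second)
    and "X *\<^sub>v unit_vec n k = plane_unit_vec n k l (- t)" (is ?third)
    and "X *\<^sub>v unit_vec n l = plane_unit_vec n l k t" (is ?fourth)
    and "\<And>a. a < n \<Longrightarrow> a \<notin> {i, j, k, l} \<Longrightarrow> X *\<^sub>v unit_vec n a = unit_vec n a"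
proof -
  obtain \<sigma> \<theta> where "plane_rotations n \<sigma> \<theta>"
    and generator: "of_real s \<cdot>\<^sub>m skew n (Suc i) (Suc j) + of_real t \<cdot>\<^sub>m skew n (Suc k) (Suc l)
      = plane_rotations.generator n \<sigma> \<theta>"
    and \<sigma>: "\<sigma> i = j" "\<sigma> j = i" "\<sigma> k = l" "\<sigma> l = k"
    and \<theta>: "\<theta> i = s" "\<theta> j = - s" "\<theta> k = t" "\<theta> l = - t" "\<And>a. a \<notin> {i, j, k, l} \<Longrightarrow> \<theta> a = 0"
    by (rule plane_rotations_skew_pair[OF less distinct, where s = s and t = t]) (rule that)
  interpret plane_rotations n \<sigma> \<theta> by fact
  have X: "X = rotation" unfolding X_def generator by (rule mat_exp_generator)
  show ?unitary unfolding X by (rule rotation_unitary)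
  show ?first ?second ?third ?fourth
    unfolding X by (simp_all add: rotation_mult_unit_vec less \<sigma> \<theta>)
  show "X *\<^sub>v unit_vec n a = unit_vec n a" if "a < n" "a \<notin> {i, j, k, l}" for a
    unfolding X by (intro rotation_fixes_unit_vec \<theta>(5) that)
qed

section \<open>Reduction of two-by-two matrices\<close>

lemma unit_eigenvector_exists:
  fixes A :: "complex mat"
  assumes A: "A \<in> carrier_mat n n" and "n > 0"
  obtains v \<nu> where "v \<in> carrier_vec n" "A *\<^sub>v v = \<nu> \<cdot>\<^sub>v v" "v \<bullet>c v = 1"
proof -
  obtain u \<nu> where u: "u \<in> carrier_vec n" "u \<noteq> 0\<^sub>v n" "A *\<^sub>v u = \<nu> \<cdot>\<^sub>v u"
    using spectrum_non_empty[OF assms] A by (auto simp: spectrum_def eigenvalue_def eigenvector_def)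
  define N where "N = sqrt (Re (u \<bullet>c u))"
  have pos: "u \<bullet>c u > 0" using u by simp
  then have N: "N > 0" "of_real N * of_real N = u \<bullet>c u"
    by (auto simp: N_def less_complex_def complex_eq_iff simp flip: of_real_mult)
  define v where "v = of_real (inverse N) \<cdot>\<^sub>v u"
  have "v \<bullet>c v = of_real (inverse N) * (of_real (inverse N) * (u \<bullet>c u))"
    using u by (simp add: v_def conjugate_smult_vec)
  also have "\<dots> = 1" using N(1) by (simp add: field_simps flip: N(2))
  finally show ?thesis
    using u A
    by (intro that[of v \<nu>]) (simp_all add: v_def mult_mat_vec smult_smult_assoc mult.commute)
qed

lemma unimodular_multiple_real:
  fixes z :: complex
  obtains \<mu> where "cnj \<mu> * \<mu> = 1" "\<mu> * z \<in> \<real>"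
proof
  show "cnj (cis (- Arg z)) * cis (- Arg z) = 1" by (simp add: cis_cnj cis_mult)
  have "cis (- Arg z) * z = of_real (cmod z)"
    by (subst (2) rcis_cmod_Arg[of z, symmetric]) (simp add: rcis_def cis_mult mult.left_commute)
  then show "cis (- Arg z) * z \<in> \<real>" by simp
qed

definition unitary_completion :: "complex vec \<Rightarrow> complex \<Rightarrow> complex mat" where
  "unitary_completion v \<mu>
    = mat 2 2 (\<lambda>(i, j). if j = 0 then if i = 0 then - cnj (v $ 1) else cnj (v $ 0) else \<mu> * v $ i)"

lemma dim_unitary_completion [simp]:
  "dim_row (unitary_completion v \<mu>) = 2" "dim_col (unitary_completion v \<mu>) = 2"
  by (simp_all add: unitary_completion_def)

lemma unitary_completion_unitary:
  assumes v: "v \<in> carrier_vec 2" "v \<bullet>c v = 1" and \<mu>: "cnj \<mu> * \<mu> = 1"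
  shows "unitary_completion v \<mu> \<in> unitary_group 2"
proof -
  have norm: "v $ 0 * cnj (v $ 0) + v $ 1 * cnj (v $ 1) = 1"
    using v by (simp add: scalar_prod_def numeral_2_eq_2)
  have phase_cancel: "\<mu> * (cnj \<mu> * z) = z" for z
    using \<mu> by (metis mult.assoc mult.commute mult_1)
  have "(mat_adjoint (unitary_completion v \<mu>) * unitary_completion v \<mu>) $$ (i, j) = 1\<^sub>m 2 $$ (i, j)"
    if "i < 2" "j < 2" for i j
    using that norm
    by (auto simp: index_mult_mat_sum less_2_cases_iff simp del: index_mult_mat(1))
      (simp_all add: unitary_completion_def numeral_2_eq_2 phase_cancel algebra_simps)
  then show ?thesis by (auto simp: unitary_group_def intro!: eq_matI)
qed

lemma unitary_completion_conjugate_index: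
  assumes "A \<in> carrier_mat 2 2" "v \<in> carrier_vec 2"
  shows "(mat_adjoint (unitary_completion v \<mu>) * (A * unitary_completion v \<mu>)) $$ (0, 1)
    = \<mu> * (v $ 0 * (A *\<^sub>v v) $ 1 - v $ 1 * (A *\<^sub>v v) $ 0)"
  using assms
  by (simp add: index_mult_mat_sum scalar_prod_def del: index_mult_mat(1))
    (simp add: unitary_completion_def numeral_2_eq_2 algebra_simps)

text \<open>The second column of \<open>V\<close> is a unit eigenvector of \<open>P\<close>, so that \<open>P\<close> maps it into the orthogonal
  complement of the first one; the remaining phase makes the corresponding entry of \<open>Q\<close> real.\<close>
lemma simultaneous_unitary_reduction:
  fixes P Q :: "complex mat"
  assumes P: "P \<in> carrier_mat 2 2" and Q: "Q \<in> carrier_mat 2 2"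
  obtains V where "V \<in> unitary_group 2"
    "(mat_adjoint V * (P * V)) $$ (0, 1) = 0" "(mat_adjoint V * (Q * V)) $$ (0, 1) \<in> \<real>"
proof -
  obtain v \<nu> where v: "v \<in> carrier_vec 2" and eigen: "P *\<^sub>v v = \<nu> \<cdot>\<^sub>v v" and unit: "v \<bullet>c v = 1"
    using unit_eigenvector_exists[OF P] by auto
  obtain \<mu> where \<mu>: "cnj \<mu> * \<mu> = 1" "\<mu> * (v $ 0 * (Q *\<^sub>v v) $ 1 - v $ 1 * (Q *\<^sub>v v) $ 0) \<in> \<real>"
    by (rule unimodular_multiple_real)
  show ?thesis
  proof (rule that[OF unitary_completion_unitary[OF v unit \<mu>(1)]])
    show "(mat_adjoint (unitary_completion v \<mu>) * (P * unitary_completion v \<mu>)) $$ (0, 1) = 0"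
      unfolding unitary_completion_conjugate_index[OF P v] eigen using v by simp
    show "(mat_adjoint (unitary_completion v \<mu>) * (Q * unitary_completion v \<mu>)) $$ (0, 1) \<in> \<real>"
      unfolding unitary_completion_conjugate_index[OF Q v] by (rule \<mu>(2))
  qed
qed

section \<open>Solving for the angles\<close>

lemma polar_with_radius:
  fixes x y R :: real
  assumes "R\<^sup>2 = x\<^sup>2 + y\<^sup>2"
  obtains \<phi> where "x = R * cos \<phi>" "y = R * sin \<phi>"
proof (cases "R = 0")
  case True
  then show ?thesis using assms that by auto
next
  case False
  then have "(x / R)\<^sup>2 + (y / R)\<^sup>2 = 1"
    using assms by (simp add: power_divide flip: add_divide_distrib assms)
  then obtain \<phi> where "x / R = cos \<phi>" "y / R = sin \<phi>" using sincos_total_2pi by metis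
  then show ?thesis using that[of \<phi>] False by (simp add: field_simps)
qed

lemma spherical_coordinates:
  fixes x y z R :: real
  assumes "R\<^sup>2 = x\<^sup>2 + y\<^sup>2 + z\<^sup>2"
  obtains s a where "x = R * cos s" "y = R * sin s * sin a" "z = R * sin s * cos a"
proof -
  define S where "S = sqrt (z\<^sup>2 + y\<^sup>2)"
  have S: "S\<^sup>2 = z\<^sup>2 + y\<^sup>2" by (simp add: S_def)
  then have "R\<^sup>2 = x\<^sup>2 + S\<^sup>2" using assms by simp
  then obtain s where s: "x = R * cos s" "S = R * sin s" by (rule polar_with_radius)
  obtain a where "z = S * cos a" "y = S * sin a" using S by (rule polar_with_radius)
  then show ?thesis using that[of s a] s by simp
qed

lemma hyperspherical_coordinates:
  fixes x y z w R :: real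
  assumes "R\<^sup>2 = w\<^sup>2 + x\<^sup>2 + y\<^sup>2 + z\<^sup>2"
  obtains t \<theta> b where "w = R * cos t" "x = R * sin t * sin \<theta>"
    "y = R * sin t * cos \<theta> * sin b" "z = R * sin t * cos \<theta> * cos b"
proof -
  define C where "C = sqrt (z\<^sup>2 + y\<^sup>2)"
  have C: "C\<^sup>2 = z\<^sup>2 + y\<^sup>2" by (simp add: C_def)
  then have "R\<^sup>2 = w\<^sup>2 + x\<^sup>2 + C\<^sup>2" using assms by simp
  then obtain t \<theta> where t: "w = R * cos t" "x = R * sin t * sin \<theta>" "C = R * sin t * cos \<theta>"
    by (rule spherical_coordinates)
  obtain b where "z = C * cos b" "y = C * sin b" using C by (rule polar_with_radius)
  then show ?thesis using that[of t \<theta> b] t by simp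
qed

text \<open>The equations say that the blockwise Gram matrices of the first two columns of an element of
  \<open>A\<^sub>2 A' A\<^sub>1\<close> are prescribed. In the last two blocks, \<open>p\<close> is up to sign the length of the part of the
  second column that is blockwise parallel to the first one, and \<open>r1\<close>, \<open>r2\<close> are the squared lengths
  of the remaining parts. Division by zero is harmless: \<open>u1 u2 = 0\<close> forces \<open>v = 0\<close>.\<close>
lemma gram_angles:
  fixes u0 u1 u2 v w0 w1 w2 :: real
  assumes nonneg: "u0 \<ge> 0" "u1 \<ge> 0" "u2 \<ge> 0" "w0 \<ge> 0" "w1 \<ge> 0" "w2 \<ge> 0"
    and sums: "u0 + u1 + u2 = 1" "w0 + w1 + w2 = 1"
    and Cauchy_Schwarz: "v\<^sup>2 \<le> u1 * w1" "v\<^sup>2 \<le> u2 * w2"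
  obtains s t a b \<theta> where
    "(cos s)\<^sup>2 = u0" "(sin s * sin a)\<^sup>2 = u1" "(sin s * cos a)\<^sup>2 = u2"
    "(cos t)\<^sup>2 = w0" "(sin t * sin \<theta> * cos a)\<^sup>2 + (sin t * cos \<theta> * sin b)\<^sup>2 = w1"
    "(sin t * sin \<theta> * sin a)\<^sup>2 + (sin t * cos \<theta> * cos b)\<^sup>2 = w2"
    "sin s * sin a * (sin t * sin \<theta> * cos a) = v"
proof -
  obtain s a where s: "sqrt u0 = cos s" and u: "sqrt u1 = sin s * sin a" "sqrt u2 = sin s * cos a"
    using spherical_coordinates[of 1 "sqrt u0" "sqrt u1" "sqrt u2"] nonneg sums by auto
  define p where "p = v / (sin s * sin a * cos a)"
  define r1 where "r1 = w1 - v\<^sup>2 / u1"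
  define r2 where "r2 = w2 - v\<^sup>2 / u2"
  have v_eq_0: "v = 0" if "u1 = 0 \<or> u2 = 0" using that Cauchy_Schwarz by auto
  have remainder_nonneg: "r1 \<ge> 0" "r2 \<ge> 0"
    using nonneg Cauchy_Schwarz unfolding r1_def r2_def
    by (cases "u1 = 0", simp_all add: field_simps) (cases "u2 = 0", simp_all add: field_simps)
  have p: "p * cos a = v / sqrt u1" "p * sin a = v / sqrt u2"
    using u v_eq_0 by (cases "sin a = 0 \<or> cos a = 0"; auto simp: p_def)+
  have "p\<^sup>2 = (p * cos a)\<^sup>2 + (p * sin a)\<^sup>2"
    by (simp add: power_mult_distrib flip: distrib_left)
  then have "1\<^sup>2 = (sqrt w0)\<^sup>2 + p\<^sup>2 + (sqrt r1)\<^sup>2 + (sqrt r2)\<^sup>2"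
    using nonneg remainder_nonneg sums by (simp add: p power_divide r1_def r2_def)
  then obtain t \<theta> b where t: "sqrt w0 = cos t" "p = sin t * sin \<theta>"
    "sqrt r1 = sin t * cos \<theta> * sin b" "sqrt r2 = sin t * cos \<theta> * cos b"
    by (rule hyperspherical_coordinates[where R = 1]) (simp only: mult_1)
  show ?thesis
  proof (rule that[of s a t \<theta> b])
    show "(cos s)\<^sup>2 = u0" "(cos t)\<^sup>2 = w0" "(sin s * sin a)\<^sup>2 = u1" "(sin s * cos a)\<^sup>2 = u2"
      using nonneg by (simp_all flip: s t u)
    have "(p * cos a)\<^sup>2 + (sqrt r1)\<^sup>2 = w1" "(p * sin a)\<^sup>2 + (sqrt r2)\<^sup>2 = w2"
      using nonneg remainder_nonneg by (simp_all add: p power_divide r1_def r2_def)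
    then show "(sin t * sin \<theta> * cos a)\<^sup>2 + (sin t * cos \<theta> * sin b)\<^sup>2 = w1"
      "(sin t * sin \<theta> * sin a)\<^sup>2 + (sin t * cos \<theta> * cos b)\<^sup>2 = w2"
      by (simp_all add: t)
    have "sqrt u1 * (p * cos a) = v" unfolding p using v_eq_0 by auto
    then show "sin s * sin a * (sin t * sin \<theta> * cos a) = v" by (simp add: t u)
  qed
qed

section \<open>The decomposition\<close>

lemma blk3_range: "blk3 n1 n2 ` I \<subseteq> {0, 1, 2}"
  by (auto simp: blk3_def)

text \<open>Indices start at \<open>0\<close>: the positions \<open>1, 2, n\<^sub>1 + 1, n\<^sub>1 + 2, n - 1, n\<close> of the paper are
  \<open>0\<close>, \<open>Suc 0\<close>, \<open>n1\<close>, \<open>Suc n1\<close>, \<open>m\<close>, \<open>Suc m\<close>.\<close>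
locale three_blocks =
  fixes n n1 n2 n3 m :: nat
  assumes size: "n = n1 + n2 + n3" "n = m + 2" and two_le: "2 \<le> n1" "2 \<le> n2" "2 \<le> n3"
begin

definition exp_a1 :: "real \<Rightarrow> real \<Rightarrow> complex mat" where
  "exp_a1 s t = mat_exp (of_real s \<cdot>\<^sub>m skew n (Suc 0) (Suc (Suc m))
     + of_real t \<cdot>\<^sub>m skew n (Suc (Suc 0)) (Suc m))"

definition exp_a' :: "real \<Rightarrow> complex mat" where
  "exp_a' \<theta> = mat_exp (of_real \<theta> \<cdot>\<^sub>m skew n (Suc n1) (Suc m))"

definition exp_a2 :: "real \<Rightarrow> real \<Rightarrow> complex mat" where
  "exp_a2 a b = mat_exp (of_real a \<cdot>\<^sub>m skew n (Suc n1) (Suc (Suc m))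
     + of_real b \<cdot>\<^sub>m skew n (Suc (Suc n1)) (Suc m))"

lemma mat_exp_image_eq:
  "mat_exp ` rspan2 (skew n 1 n) (skew n 2 (n - 1)) = {exp_a1 s t | s t. True}"
  "mat_exp ` rspan1 (skew n (n1 + 1) (n - 1)) = range exp_a'"
  "mat_exp ` rspan2 (skew n (n1 + 1) n) (skew n (n1 + 2) (n - 1)) = {exp_a2 a b | a b. True}"
proof -
  have "skew n 1 n = skew n (Suc 0) (Suc (Suc m))" "skew n 2 (n - 1) = skew n (Suc (Suc 0)) (Suc m)"
    "skew n (n1 + 1) (n - 1) = skew n (Suc n1) (Suc m)"
    "skew n (n1 + 1) n = skew n (Suc n1) (Suc (Suc m))"
    "skew n (n1 + 2) (n - 1) = skew n (Suc (Suc n1)) (Suc m)"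
    by (simp_all add: size(2) numeral_2_eq_2)
  then show "mat_exp ` rspan2 (skew n 1 n) (skew n 2 (n - 1)) = {exp_a1 s t | s t. True}"
    "mat_exp ` rspan1 (skew n (n1 + 1) (n - 1)) = range exp_a'"
    "mat_exp ` rspan2 (skew n (n1 + 1) n) (skew n (n1 + 2) (n - 1)) = {exp_a2 a b | a b. True}"
    by (auto simp only: exp_a1_def exp_a'_def exp_a2_def rspan1_def rspan2_def image_def)
qed

definition torus_product :: "real \<Rightarrow> real \<Rightarrow> real \<Rightarrow> real \<Rightarrow> real \<Rightarrow> complex mat" where
  "torus_product a b \<theta> s t = exp_a2 a b * exp_a' \<theta> * exp_a1 s t"

lemma index_less: "0 < n" "Suc 0 < n" "n1 < n" "Suc n1 < n" "m < n" "Suc m < n"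
  using size two_le by auto

lemma index_neq:
  "n1 \<noteq> 0" "n1 \<noteq> Suc 0" "m \<noteq> 0" "m \<noteq> Suc 0" "n1 \<noteq> m" "n1 \<noteq> Suc m" "Suc n1 \<noteq> m"
  using size two_le by auto

lemma blk3_index:
  "blk3 n1 n2 0 = 0" "blk3 n1 n2 (Suc 0) = 0" "blk3 n1 n2 n1 = 1" "blk3 n1 n2 (Suc n1) = 1"
  "blk3 n1 n2 m = 2" "blk3 n1 n2 (Suc m) = 2"
  using size two_le by (auto simp: blk3_def)

lemma distinct_planes: "distinct [0, Suc m, Suc 0, m]" "distinct [n1, Suc m, Suc n1, m]"
  by (simp_all add: index_neq index_neq[symmetric])

lemma exp_a1_rotation:
  shows exp_a1_unitary: "exp_a1 s t \<in> unitary_group n"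
    and "exp_a1 s t *\<^sub>v unit_vec n 0 = plane_unit_vec n 0 (Suc m) (- s)"
    and "exp_a1 s t *\<^sub>v unit_vec n (Suc 0) = plane_unit_vec n (Suc 0) m (- t)"
  unfolding exp_a1_def by (rule mat_exp_skew_pair[OF index_less(1,6,2,5) distinct_planes(1)])+

lemma exp_a'_rotation:
  shows exp_a'_unitary: "exp_a' \<theta> \<in> unitary_group n"
    and "exp_a' \<theta> *\<^sub>v unit_vec n m = plane_unit_vec n m n1 \<theta>"
    and "i < n \<Longrightarrow> i \<notin> {n1, m} \<Longrightarrow> exp_a' \<theta> *\<^sub>v unit_vec n i = unit_vec n i"
  unfolding exp_a'_def by (rule mat_exp_skew[OF index_less(3,5) index_neq(5)]; assumption?)+

lemma exp_a2_rotation: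
  shows exp_a2_unitary: "exp_a2 a b \<in> unitary_group n"
    and "exp_a2 a b *\<^sub>v unit_vec n n1 = plane_unit_vec n n1 (Suc m) (- a)"
    and "exp_a2 a b *\<^sub>v unit_vec n (Suc m) = plane_unit_vec n (Suc m) n1 a"
    and "exp_a2 a b *\<^sub>v unit_vec n m = plane_unit_vec n m (Suc n1) b"
    and "i < n \<Longrightarrow> i \<notin> {n1, Suc m, Suc n1, m} \<Longrightarrow> exp_a2 a b *\<^sub>v unit_vec n i = unit_vec n i"
  unfolding exp_a2_def
  by (rule mat_exp_skew_pair[OF index_less(3,6,4,5) distinct_planes(2)]; assumption?)+

lemma torus_product_unitary: "torus_product a b \<theta> s t \<in> unitary_group n"
  unfolding torus_product_def
  by (intro unitary_group_mult exp_a1_unitary exp_a'_unitary exp_a2_unitary)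

lemma torus_product_mult_vec:
  assumes "v \<in> carrier_vec n"
  shows "torus_product a b \<theta> s t *\<^sub>v v = exp_a2 a b *\<^sub>v (exp_a' \<theta> *\<^sub>v (exp_a1 s t *\<^sub>v v))"
proof -
  have "exp_a1 s t \<in> carrier_mat n n" "exp_a' \<theta> \<in> carrier_mat n n" "exp_a2 a b \<in> carrier_mat n n"
    by (intro unitary_group_carrier exp_a1_unitary exp_a'_unitary exp_a2_unitary)+
  then show ?thesis
    using assms by (simp add: torus_product_def assoc_mult_mat_vec[of _ n n _ n])
qed

lemmas torus_product_expand = torus_product_mult_vec exp_a1_rotation exp_a'_rotation exp_a2_rotation
  unitary_group_mult_combination[OF exp_a'_unitary]
  unitary_group_mult_combination[OF exp_a2_unitary]

lemma torus_product_column_0: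
  "torus_product a b \<theta> s t *\<^sub>v unit_vec n 0
    = of_real (cos s) \<cdot>\<^sub>v unit_vec n 0 + of_real (- sin s) \<cdot>\<^sub>v plane_unit_vec n (Suc m) n1 a"
  by (simp add: torus_product_expand index_less index_neq index_neq[symmetric])

lemma torus_product_column_1:
  "torus_product a b \<theta> s t *\<^sub>v unit_vec n (Suc 0)
    = of_real (cos t) \<cdot>\<^sub>v unit_vec n (Suc 0) + of_real (- sin t) \<cdot>\<^sub>v
        (of_real (cos \<theta>) \<cdot>\<^sub>v plane_unit_vec n m (Suc n1) b
         + of_real (sin \<theta>) \<cdot>\<^sub>v plane_unit_vec n n1 (Suc m) (- a))"
  by (simp add: torus_product_expand index_less index_neq index_neq[symmetric])

definition torus_frame :: "real \<Rightarrow> real \<Rightarrow> real \<Rightarrow> real \<Rightarrow> real \<Rightarrow> complex mat" where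
  "torus_frame a b \<theta> s t = torus_product a b \<theta> s t * coordinate_frame n 2"

lemma torus_frame_carrier: "torus_frame a b \<theta> s t \<in> carrier_mat n 2"
  using unitary_group_dim[OF torus_product_unitary] by (auto simp: torus_frame_def)

lemma index_block_gram_torus_frame:
  assumes "i < 2" "j < 2"
  shows "block_gram n blk k (torus_frame a b \<theta> s t) $$ (i, j) =
    block_inner n blk k (torus_product a b \<theta> s t *\<^sub>v unit_vec n i)
      (torus_product a b \<theta> s t *\<^sub>v unit_vec n j)"
proof -
  have "col (torus_frame a b \<theta> s t) r = torus_product a b \<theta> s t *\<^sub>v unit_vec n r" if "r < 2" for r
    unfolding torus_frame_def
    by (rule col_mult_coordinate_frame[OF unitary_group_carrier[OF torus_product_unitary] that])
  then show ?thesis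
    using assms torus_frame_carrier[of a b \<theta> s t] by (simp only: index_block_gram carrier_matD)
qed

lemma block_gram_torus_frame:
  fixes a b \<theta> s t k
  defines "G \<equiv> block_gram n (blk3 n1 n2) k (torus_frame a b \<theta> s t)"
    and "c \<equiv> sin s * sin a * (sin t * sin \<theta> * cos a)"
  shows "G $$ (0, 0) = of_real (if k = 0 then (cos s)\<^sup>2 else if k = 1 then (sin s * sin a)\<^sup>2
      else if k = 2 then (sin s * cos a)\<^sup>2 else 0)"
    and "G $$ (0, 1) = of_real (if k = 1 then c else if k = 2 then - c else 0)"
    and "G $$ (1, 1) = of_real (if k = 0 then (cos t)\<^sup>2
      else if k = 1 then (sin t * sin \<theta> * cos a)\<^sup>2 + (sin t * cos \<theta> * sin b)\<^sup>2
      else if k = 2 then (sin t * sin \<theta> * sin a)\<^sup>2 + (sin t * cos \<theta> * cos b)\<^sup>2 else 0)"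
proof -
  note expand = G_def index_block_gram_torus_frame torus_product_column_0 torus_product_column_1
    block_inner_add[of _ n] block_inner_smult[of _ n] block_inner_unit_vec
    index_less index_neq index_neq[symmetric] blk3_index
  show "G $$ (0, 0) = of_real (if k = 0 then (cos s)\<^sup>2 else if k = 1 then (sin s * sin a)\<^sup>2
      else if k = 2 then (sin s * cos a)\<^sup>2 else 0)"
    by (simp add: expand power2_eq_square)
  show "G $$ (0, 1) = of_real (if k = 1 then c else if k = 2 then - c else 0)"
    by (simp add: expand c_def)
  show "G $$ (1, 1) = of_real (if k = 0 then (cos t)\<^sup>2
      else if k = 1 then (sin t * sin \<theta> * cos a)\<^sup>2 + (sin t * cos \<theta> * sin b)\<^sup>2
      else if k = 2 then (sin t * sin \<theta> * sin a)\<^sup>2 + (sin t * cos \<theta> * cos b)\<^sup>2 else 0)"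
    by (simp add: expand power2_eq_square algebra_simps)
qed

lemma reduced_frame_block_gram:
  assumes C: "C \<in> carrier_mat n 2" "mat_adjoint C * C = 1\<^sub>m 2"
    and diagonal: "block_gram n (blk3 n1 n2) 0 C $$ (0, 1) = 0"
    and real: "block_gram n (blk3 n1 n2) 1 C $$ (0, 1) \<in> \<real>"
  obtains u w :: "nat \<Rightarrow> real" and v :: real where
    "\<And>k. block_gram n (blk3 n1 n2) k C $$ (0, 0) = of_real (u k)"
    "\<And>k. block_gram n (blk3 n1 n2) k C $$ (1, 1) = of_real (w k)"
    "block_gram n (blk3 n1 n2) 1 C $$ (0, 1) = of_real v"
    "block_gram n (blk3 n1 n2) 2 C $$ (0, 1) = of_real (- v)"
    "\<And>k. u k \<ge> 0" "\<And>k. w k \<ge> 0" "u 0 + u 1 + u 2 = 1" "w 0 + w 1 + w 2 = 1"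
    "v\<^sup>2 \<le> u 1 * w 1" "v\<^sup>2 \<le> u 2 * w 2"
proof -
  let ?gram = "block_gram n (blk3 n1 n2)"
  define u where "u k = Re (?gram k C $$ (0, 0))" for k
  define w where "w k = Re (?gram k C $$ (1, 1))" for k
  have diag: "?gram k C $$ (0, 0) = of_real (u k)" "?gram k C $$ (1, 1) = of_real (w k)" for k
    unfolding u_def w_def using C by (intro block_gram_diag; simp)+
  have nonneg: "u k \<ge> 0" "w k \<ge> 0" for k
    unfolding u_def w_def using C by (intro block_gram_diag; simp)+
  have total: "?gram 0 C $$ (i, j) + ?gram 1 C $$ (i, j) + ?gram 2 C $$ (i, j) = of_bool (i = j)"
    if "i < 2" "j < 2" for i j
    using sum_block_gram[of "{0, 1, 2}" "blk3 n1 n2" n C i j] blk3_range C that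
    by (simp add: add.assoc)
  obtain v where v: "?gram 1 C $$ (0, 1) = of_real v" "?gram 2 C $$ (0, 1) = of_real (- v)"
    using real total[of 0 1] diagonal
    by (elim Reals_cases) (simp add: add_eq_0_iff del: One_nat_def)
  have "complex_of_real (u 0 + u 1 + u 2) = 1" "complex_of_real (w 0 + w 1 + w 2) = 1"
    using total[of 0 0] total[of 1 1] unfolding diag by simp_all
  then have sums: "u 0 + u 1 + u 2 = 1" "w 0 + w 1 + w 2 = 1" unfolding of_real_eq_1_iff by auto
  have "(cmod (?gram k C $$ (0, 1)))\<^sup>2 \<le> u k * w k" for k
    unfolding u_def w_def using C by (intro block_gram_Cauchy_Schwarz) auto
  from this[of 1] this[of 2] have "v\<^sup>2 \<le> u 1 * w 1" "v\<^sup>2 \<le> u 2 * w 2"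
    by (simp_all only: v norm_of_real power2_abs power2_minus)
  with diag v nonneg sums show ?thesis by (rule that)
qed

lemma torus_frame_with_block_gram:
  assumes C: "C \<in> carrier_mat n 2" "mat_adjoint C * C = 1\<^sub>m 2"
    and diagonal: "block_gram n (blk3 n1 n2) 0 C $$ (0, 1) = 0"
    and real: "block_gram n (blk3 n1 n2) 1 C $$ (0, 1) \<in> \<real>"
  obtains a b \<theta> s t where
    "\<And>k. block_gram n (blk3 n1 n2) k (torus_frame a b \<theta> s t) = block_gram n (blk3 n1 n2) k C"
proof -
  let ?gram = "block_gram n (blk3 n1 n2)"
  obtain u w v where entries:
      "\<And>k. ?gram k C $$ (0, 0) = of_real (u k)" "\<And>k. ?gram k C $$ (1, 1) = of_real (w k)"
      "?gram 1 C $$ (0, 1) = of_real v" "?gram 2 C $$ (0, 1) = of_real (- v)"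
    and nonneg: "\<And>k. u k \<ge> 0" "\<And>k. w k \<ge> 0" and sums: "u 0 + u 1 + u 2 = 1" "w 0 + w 1 + w 2 = 1"
    and Cauchy_Schwarz: "v\<^sup>2 \<le> u 1 * w 1" "v\<^sup>2 \<le> u 2 * w 2"
    by (rule reduced_frame_block_gram[OF assms]) (rule that)
  obtain s t a b \<theta> where angles:
    "(cos s)\<^sup>2 = u 0" "(sin s * sin a)\<^sup>2 = u 1" "(sin s * cos a)\<^sup>2 = u 2"
    "(cos t)\<^sup>2 = w 0" "(sin t * sin \<theta> * cos a)\<^sup>2 + (sin t * cos \<theta> * sin b)\<^sup>2 = w 1"
    "(sin t * sin \<theta> * sin a)\<^sup>2 + (sin t * cos \<theta> * cos b)\<^sup>2 = w 2"
    "sin s * sin a * (sin t * sin \<theta> * cos a) = v"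
    by (rule gram_angles[OF nonneg(1,1,1,2,2,2) sums Cauchy_Schwarz])
  have "?gram k (torus_frame a b \<theta> s t) = ?gram k C" for k
  proof (cases "k \<in> {0, 1, 2}")
    case True
    then show ?thesis
      by (intro block_gram_two_columns_eqI[OF torus_frame_carrier C(1)])
        (auto simp: block_gram_torus_frame angles entries diagonal simp del: One_nat_def)
  next
    case False
    then have "k \<notin> blk3 n1 n2 ` {..<n}" using blk3_range by blast
    then show ?thesis
      using torus_frame_carrier[of a b \<theta> s t] C(1) by (simp add: block_gram_empty_block)
  qed
  then show ?thesis by (rule that)
qed

lemma unitary_group_decomposition:
  assumes g: "g \<in> unitary_group n"
  obtains l h a b \<theta> s t where "l \<in> block_subgroup n (blk3 n1 n2)" "h \<in> block_subgroup n (blk2 2)"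
    "g = l * torus_product a b \<theta> s t * h"
proof -
  let ?gram = "block_gram n (blk3 n1 n2)" and ?E = "coordinate_frame n 2"
  note dim = unitary_group_dim[OF g]
  obtain V where V: "V \<in> unitary_group 2"
    and reduced: "(mat_adjoint V * (?gram 0 (g * ?E) * V)) $$ (0, 1) = 0"
      "(mat_adjoint V * (?gram 1 (g * ?E) * V)) $$ (0, 1) \<in> \<real>"
    by (rule simultaneous_unitary_reduction[of "?gram 0 (g * ?E)" "?gram 1 (g * ?E)"]) auto
  have gram: "?gram k (g * ?E * V) = mat_adjoint V * (?gram k (g * ?E) * V)" for k
    using dim unitary_group_dim[OF V] by (intro block_gram_mult_right) auto
  have "mat_adjoint (g * ?E * V) * (g * ?E * V) = mat_adjoint V * (mat_adjoint ?E * ?E * V)"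
    using dim unitary_group_dim[OF V] unitary_group_cancel(1)[OF g]
    by (simp add: mat_adjoint_mult assoc_mult_mat_dim)
  also have "\<dots> = 1\<^sub>m 2"
    using unitary_group_dim[OF V] unitary_group_adjoint_mult[OF V] two_le size
    by (simp add: coordinate_frame_orthonormal)
  finally have orthonormal: "mat_adjoint (g * ?E * V) * (g * ?E * V) = 1\<^sub>m 2" .
  have carrier: "g * ?E * V \<in> carrier_mat n 2"
    using dim unitary_group_dim[OF V] by auto
  obtain a b \<theta> s t where "\<And>k. ?gram k (torus_frame a b \<theta> s t) = ?gram k (g * ?E * V)"
    using torus_frame_with_block_gram[OF carrier orthonormal reduced[folded gram]] by blast
  then obtain l h where "l \<in> block_subgroup n (blk3 n1 n2)" "h \<in> block_subgroup n (blk2 2)"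
    "g = l * torus_product a b \<theta> s t * h"
    using double_coset_if_block_gram_eq[OF g torus_product_unitary V]
    unfolding torus_frame_def by metis
  then show ?thesis by (rule that)
qed

end

theorem theorem4p1:
  fixes n n1 n2 n3 p q :: nat
  assumes "n = n1 + n2 + n3" and "n = p + q"
    and "min n1 (min n2 n3) \<ge> 2"
    and "p = 2" and "q = n - 2"
  defines "G \<equiv> unitary_group n"
    and "L \<equiv> block_subgroup n (blk3 n1 n2)"
    and "H \<equiv> block_subgroup n (blk2 p)"
    and "A1 \<equiv> mat_exp ` rspan2 (skew n 1 n) (skew n 2 (n - 1))"
    and "A' \<equiv> mat_exp ` rspan1 (skew n (n1 + 1) (n - 1))"
    and "A2 \<equiv> mat_exp ` rspan2 (skew n (n1 + 1) n) (skew n (n1 + 2) (n - 1))"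
  shows "G = {l * (x * y * z) * h | l x y z h.
              l \<in> L \<and> x \<in> A2 \<and> y \<in> A' \<and> z \<in> A1 \<and> h \<in> H}"
    (is "_ = ?LBH")
proof -
  interpret three_blocks n n1 n2 n3 "n - 2"
    using assms(1,3) by unfold_locales auto
  note exponentials = A1_def A'_def A2_def mat_exp_image_eq
  have "g \<in> ?LBH" if "g \<in> G" for g
  proof -
    from that obtain l h a b \<theta> s t where "l \<in> L" "h \<in> H"
      "g = l * (exp_a2 a b * exp_a' \<theta> * exp_a1 s t) * h"
      unfolding G_def L_def H_def \<open>p = 2\<close> torus_product_def[symmetric]
      by (elim unitary_group_decomposition)
    then show ?thesis unfolding exponentials by blast
  qed
  moreover have "g \<in> G" if "g \<in> ?LBH" for g
  proof -
    from that obtain l x y z h where g: "g = l * (x * y * z) * h"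
      and "l \<in> L" "x \<in> A2" "y \<in> A'" "z \<in> A1" "h \<in> H" by blast
    then have "{l, x, y, z, h} \<subseteq> unitary_group n"
      unfolding L_def H_def exponentials
      using block_subgroup_unitary exp_a1_unitary exp_a'_unitary exp_a2_unitary by blast
    then show ?thesis unfolding g G_def by (auto intro!: unitary_group_mult)
  qed
  ultimately show ?thesis by blast
qed

end
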